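(* Let $x=P(x)$ be a probabilistic polynomial system (PPS) in $n$ variables that is in simple normal form (SNF), and suppose its least fixed point $q^*$ satisfies $\mathbf{0} < q^* < \mathbf{1}$ (coordinatewise). Let $x^{(0)} := \mathbf{0}$ and $x^{(k+1)} := \mathcal{N}_P(x^{(k)})$ for $k \ge 0$. Then for every integer $j \geq 0$, $$\| q^* - x^{(j + 4|P|)}\|_{\infty} \leq 2^{-j}.$$
   Context: A PPS is a system $x_i = P_i(x)$, $i=1,\dots,n$, $x=(x_1,\dots,x_n)$, where each $P_i$ is a multivariate polynomial with nonnegative rational coefficients (including the constant term) whose sum is at most $1$. Its least fixed point (LFP) $q^*\in[0,1]^n$ is the coordinatewise least nonnegative solution of $x=P(x)$. The PPS is in simple normal form (SNF) if every $P_i$ is either a quadratic monomial $x_jx_k$, or a linear expression $\sum_{j\in C_i} p_{i,j}x_j + p_{i,0}$ with nonnegative rational coefficients summing to at most $1$. $|P|$ denotes $n$ plus the total number of bits of all nonzero coefficients (rationals given by numerator and denominator in binary) and nonzero exponents of all the polynomials. $B(x)$ denotes the Jacobian matrix of $P$, $B(x)_{i,j} = \partial P_i(x)/\partial x_j$, and the Newton operator is $\mathcal{N}_P(z) := z + (I-B(z))^{-1}(P(z)-z)$. *)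

theory Defs
  imports "HOL-Analysis.Analysis" "HOL-Library.Poly_Mapping" "HOL-Library.Log_Nat"
begin

(* Monomials are exponent vectors, polynomials are finitely supported rational coefficient
   functions on monomials; the n variables are indexed by the finite type 'n, n = CARD('n). *)
type_synonym 'n monomial = "'n \<Rightarrow>\<^sub>0 nat"
type_synonym 'n polynomial = "'n monomial \<Rightarrow>\<^sub>0 rat"
type_synonym 'n poly_system = "'n \<Rightarrow> 'n polynomial"

definition eval_polynomial :: "'n::finite polynomial \<Rightarrow> real ^ 'n \<Rightarrow> real" where
  "eval_polynomial p x =
     (\<Sum>m\<in>Poly_Mapping.keys p. of_rat (Poly_Mapping.lookup p m) *
        (\<Prod>j\<in>UNIV. (x $ j) ^ Poly_Mapping.lookup m j))"

definition eval_system :: "'n::finite poly_system \<Rightarrow> real ^ 'n \<Rightarrow> real ^ 'n" where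
  "eval_system P x = (\<chi> i. eval_polynomial (P i) x)"

definition substochastic :: "'n polynomial \<Rightarrow> bool" where
  "substochastic p \<longleftrightarrow>
     (\<forall>m. 0 \<le> Poly_Mapping.lookup p m) \<and>
     (\<Sum>m\<in>Poly_Mapping.keys p. Poly_Mapping.lookup p m) \<le> 1"

definition is_PPS :: "'n::finite poly_system \<Rightarrow> bool" where
  "is_PPS P \<longleftrightarrow> (\<forall>i. substochastic (P i))"

definition quadratic_monomial :: "'n polynomial \<Rightarrow> bool" where
  "quadratic_monomial p \<longleftrightarrow>
     (\<exists>j k. p = Poly_Mapping.single (Poly_Mapping.single j 1 + Poly_Mapping.single k 1) 1)"

(* Every monomial that occurs is either constant (the zero exponent vector) or a single variable. *)
definition linear_expression :: "'n polynomial \<Rightarrow> bool" where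
  "linear_expression p \<longleftrightarrow>
     Poly_Mapping.keys p \<subseteq> insert 0 (range (\<lambda>j. Poly_Mapping.single j 1))"

definition in_SNF :: "'n::finite poly_system \<Rightarrow> bool" where
  "in_SNF P \<longleftrightarrow> (\<forall>i. quadratic_monomial (P i) \<or> (linear_expression (P i) \<and> substochastic (P i)))"

(* The order on real ^ 'n is the coordinatewise one. *)
definition is_LFP :: "'n::finite poly_system \<Rightarrow> real ^ 'n \<Rightarrow> bool" where
  "is_LFP P q \<longleftrightarrow>
     0 \<le> q \<and> eval_system P q = q \<and> (\<forall>y. 0 \<le> y \<and> eval_system P y = y \<longrightarrow> q \<le> y)"

(* Binary lengths of numerator and denominator in lowest terms. *)
definition rat_bits :: "rat \<Rightarrow> nat" where
  "rat_bits r = (case quotient_of r of (a, b) \<Rightarrow> nat (bitlen \<bar>a\<bar>) + nat (bitlen b))"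

(* The keys are exactly the monomials with nonzero coefficient, respectively
   the variables with nonzero exponent. *)
definition polynomial_bits :: "'n polynomial \<Rightarrow> nat" where
  "polynomial_bits p =
     (\<Sum>m\<in>Poly_Mapping.keys p. rat_bits (Poly_Mapping.lookup p m) +
        (\<Sum>j\<in>Poly_Mapping.keys m. nat (bitlen (int (Poly_Mapping.lookup m j)))))"

definition system_size :: "'n::finite poly_system \<Rightarrow> nat" where
  "system_size P = CARD('n) + (\<Sum>i\<in>UNIV. polynomial_bits (P i))"

definition Jacobian_matrix :: "'n::finite poly_system \<Rightarrow> real ^ 'n \<Rightarrow> real ^ 'n ^ 'n" where
  "Jacobian_matrix P z = jacobian (eval_system P) (at z)"

(* Meaningful only where mat 1 - Jacobian_matrix P z is invertible, since matrix_inv is total. *)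
definition newton :: "'n::finite poly_system \<Rightarrow> real ^ 'n \<Rightarrow> real ^ 'n" where
  "newton P z = z + matrix_inv (mat 1 - Jacobian_matrix P z) *v (eval_system P z - z)"

end

theory Submission
  imports Defs
begin

text \<open>
  Put \<open>v = 1 - q\<close>. By convexity \<open>B(q) v \<le> v\<close>, so \<open>I - B(x)\<close> has a nonnegative inverse for
  \<open>0 \<le> x \<le> q\<close>, and the second-order remainder of \<open>P\<close> at \<open>x\<close> shows that \<open>q - x \<le> \<lambda> v\<close> implies
  \<open>q - N(x) \<le> (\<lambda> / 2) v\<close>. It remains to see that \<open>v \<ge> 2\<close> to the power \<open>-4|P|\<close>, so that the
  iteration can start with \<open>\<lambda>\<close> equal to 2 to the power \<open>4|P|\<close>.

  Lower bounds on \<open>v\<close> propagate backwards along dependencies at the cost of the denominators of the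
  rows passed. If a row with coefficient sum less than 1 is reachable, this suffices. Otherwise
  consider a reachable bottom strongly connected component. There \<open>v = B(1) v - Q(v)\<close> with \<open>Q\<close>
  quadratic. As \<open>I - B(1)\<close> may be singular, one takes a maximal set \<open>S\<close> of quadratic rows such that
  keeping the second child only in the rows of \<open>S\<close> leaves a subcritical matrix \<open>M\<close>. Applying the
  nonnegative inverse of \<open>I - M\<close>, whose entries are quotients of determinants, to \<open>v - M v\<close>
  gives a lower bound for \<open>Q(v)\<close> that is linear in \<open>v\<close>, hence a lower bound for \<open>max v\<close>.
\<close>

section \<open>Matrices \<open>M\<close> for which \<open>I - M\<close> has a nonnegative
  inverse\<close>

text \<open>For nonnegative \<open>M\<close> this says that \<open>I - M\<close> is a nonsingular
  M-matrix, equivalently that the spectral radius of \<open>M\<close> is below 1. In this form it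
  yields signs of vectors without computing an inverse.\<close>

definition inverse_positive :: "real ^ 'n ^ 'n \<Rightarrow> bool" where
  "inverse_positive M \<longleftrightarrow> (\<forall>z. M *v z \<le> z \<longrightarrow> 0 \<le> z)"

lemma inverse_positiveD: "inverse_positive M \<Longrightarrow> M *v z \<le> z \<Longrightarrow> 0 \<le> z"
  by (simp add: inverse_positive_def)

lemma inverse_positive_invertible:
  fixes M :: "real ^ 'n::finite ^ 'n"
  assumes "inverse_positive M"
  shows "invertible (mat 1 - M)"
proof -
  have "z = 0" if "(mat 1 - M) *v z = 0" for z
  proof -
    have eq: "M *v z = z"
      using that by (simp add: matrix_vector_mult_diff_rdistrib)
    have "0 \<le> z" "0 \<le> - z"
      using inverse_positiveD[OF assms, of z] inverse_positiveD[OF assms, of "- z"] eq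
      by (simp_all add: linear_neg[OF matrix_vector_mul_linear])
    then show "z = 0"
      by (simp add: less_eq_vec_def vec_eq_iff order_antisym)
  qed
  then show ?thesis
    by (metis invertible_left_inverse matrix_left_invertible_ker)
qed

lemma matrix_inv_mult:
  fixes M :: "'a::semiring_1 ^ 'n ^ 'm"
  assumes "invertible M"
  shows "M ** matrix_inv M = mat 1" "matrix_inv M ** M = mat 1"
  using someI_ex[OF assms[unfolded invertible_def]] by (simp_all add: matrix_inv_def)

text \<open>Minimum principle: if \<open>M *v z \<le> z\<close> and \<open>z\<close> has a negative
  entry, the indices minimizing \<open>z $ i / v $ i\<close> have tight rows and are closed under
  the dependencies of \<open>M\<close>, which \<open>no_closed\<close> excludes.\<close>

lemma inverse_positive_criterion:
  fixes M :: "real ^ 'n::finite ^ 'n"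
  assumes nonneg: "\<And>i j. 0 \<le> M $ i $ j"
    and pos: "\<And>i. 0 < v $ i"
    and sub: "M *v v \<le> v"
    and no_closed: "\<And>T. T \<noteq> {} \<Longrightarrow>
      (\<And>i. i \<in> T \<Longrightarrow> (M *v v) $ i = v $ i) \<Longrightarrow>
      (\<And>i j. i \<in> T \<Longrightarrow> 0 < M $ i $ j \<Longrightarrow> j \<in> T) \<Longrightarrow> False"
  shows "inverse_positive M"
  unfolding inverse_positive_def
proof (intro allI impI)
  fix z assume z: "M *v z \<le> z"
  define f where "f i = z $ i / v $ i" for i
  define m where "m = Min (range f)"
  have m_le: "m \<le> f i" for i
    unfolding m_def by simp
  have zge: "m * v $ i \<le> z $ i" for i
    using m_le[of i] pos[of i] by (simp add: f_def field_simps)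
  have "m \<ge> 0"
  proof (rule ccontr)
    assume "\<not> m \<ge> 0"
    then have m: "m < 0" by simp
    define T where "T = {i. f i = m}"
    have Tz: "z $ i = m * v $ i" if "i \<in> T" for i
      using that pos[of i] by (auto simp: T_def f_def field_simps)
    have ne: "T \<noteq> {}"
    proof -
      have "m \<in> range f" unfolding m_def by (rule Min_in) auto
      then show ?thesis by (auto simp: T_def)
    qed
    have terms: "m * (M $ i $ j * v $ j) \<le> M $ i $ j * z $ j" for i j
      using mult_left_mono[OF zge[of j] nonneg[of i j]] by (simp add: algebra_simps)
    \<comment> \<open>As \<open>m < 0\<close>, the chain \<open>m * v $ i \<le> m * (M *v v) $ i
      \<le> (M *v z) $ i \<le> z $ i = m * v $ i\<close> collapses, and equality must hold in each
      summand.\<close>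
    have tight: "(M *v v) $ i = v $ i \<and> (\<forall>j. M $ i $ j * z $ j = m * (M $ i $ j * v $ j))"
      if i: "i \<in> T" for i
    proof -
      have a: "m * v $ i \<le> m * (M *v v) $ i"
        using sub m by (simp add: less_eq_vec_def)
      have b: "m * (M *v v) $ i = (\<Sum>j\<in>UNIV. m * (M $ i $ j * v $ j))"
        by (simp add: matrix_vector_mult_def sum_distrib_left)
      have c: "(\<Sum>j\<in>UNIV. m * (M $ i $ j * v $ j)) \<le> (\<Sum>j\<in>UNIV. M $ i $ j * z $ j)"
        by (intro sum_mono terms)
      have d: "(\<Sum>j\<in>UNIV. M $ i $ j * z $ j) \<le> m * v $ i"
        using z unfolding less_eq_vec_def Tz[OF i, symmetric] by (simp add: matrix_vector_mult_def)
      have e: "(\<Sum>j\<in>UNIV. M $ i $ j * z $ j - m * (M $ i $ j * v $ j)) = 0"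
        using a b c d by (simp add: sum_subtractf)
      have "\<forall>j\<in>UNIV. M $ i $ j * z $ j - m * (M $ i $ j * v $ j) = 0"
        using e by (subst (asm) sum_nonneg_eq_0_iff) (use terms in auto)
      moreover have "m * (M *v v) $ i = m * v $ i"
        using a b c d by linarith
      then have "(M *v v) $ i = v $ i"
        using m by simp
      ultimately show ?thesis by simp
    qed
    show False
    proof (rule no_closed[OF ne])
      show "(M *v v) $ i = v $ i" if "i \<in> T" for i
        using tight[OF that] by simp
      show "j \<in> T" if "i \<in> T" "0 < M $ i $ j" for i j
      proof -
        have "M $ i $ j * z $ j = M $ i $ j * (m * v $ j)"
          using tight[OF that(1)] by (simp add: algebra_simps)
        then have "z $ j = m * v $ j" using that(2) by simp
        then show ?thesis using pos[of j] by (simp add: T_def f_def)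
      qed
    qed
  qed
  then have "0 \<le> z $ i" for i
    using zge[of i] pos[of i] by (meson mult_nonneg_nonneg less_imp_le order_trans)
  then show "0 \<le> z" by (simp add: less_eq_vec_def)
qed

section \<open>Size and integrality of determinants\<close>

text \<open>The Leibniz sum of absolute values, extended from permutations to all functions, factors
  into the product of the row sums.\<close>

lemma abs_det_le_prod_row_sums:
  fixes A :: "real ^ 'n::finite ^ 'n"
  shows "\<bar>det A\<bar> \<le> (\<Prod>i\<in>UNIV. \<Sum>j\<in>UNIV. \<bar>A $ i $ j\<bar>)"
proof -
  have "\<bar>det A\<bar> \<le> (\<Sum>p\<in>{p. p permutes (UNIV :: 'n set)}. \<Prod>i\<in>UNIV. \<bar>A $ i $ p i\<bar>)"
    unfolding det_def
    by (intro order_trans[OF sum_abs] sum_mono) (auto simp: abs_mult abs_prod sign_def)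
  also have "\<dots> \<le> (\<Sum>p\<in>PiE UNIV (\<lambda>_. UNIV). \<Prod>i\<in>UNIV. \<bar>A $ i $ p i\<bar>)"
    by (rule sum_mono2) (auto simp: prod_nonneg)
  also have "\<dots> = (\<Prod>i\<in>UNIV. \<Sum>j\<in>UNIV. \<bar>A $ i $ j\<bar>)"
    by (subst prod_sum_PiE) auto
  finally show ?thesis .
qed

text \<open>Each Leibniz product takes one entry from every row, so the row factors clear all its
  denominators.\<close>

lemma row_scaled_det_Ints:
  fixes A :: "real ^ 'n::finite ^ 'n" and d :: "'n \<Rightarrow> real"
  assumes "\<And>i j. d i * A $ i $ j \<in> \<int>"
  shows "(\<Prod>i\<in>UNIV. d i) * det A \<in> \<int>"
proof -
  have "(\<Prod>i\<in>UNIV. d i) * det A =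
    (\<Sum>p\<in>{p. p permutes (UNIV :: 'n set)}. of_int (sign p) * (\<Prod>i\<in>UNIV. d i * A $ i $ p i))"
    by (simp add: det_def sum_distrib_left prod.distrib mult_ac)
  also have "\<dots> \<in> \<int>"
    by (intro Ints_sum Ints_mult Ints_prod Ints_of_int assms)
  finally show ?thesis .
qed

lemma pos_Ints_ge_1: "x \<in> \<int> \<Longrightarrow> 0 < x \<Longrightarrow> 1 \<le> (x :: real)"
  by (auto elim!: Ints_cases)

section \<open>Systems in simple normal form and their least fixed point\<close>

text \<open>Rows in \<open>Q\<close> multiply a left and a right child, the other rows are affine.
  \<open>A\<close> and \<open>b\<close> are later set to 0 on \<open>Q\<close>, which lets their
  assumptions range over all rows.\<close>

locale snf =
  fixes Q :: "'n::finite set"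
    and lc rc :: "'n \<Rightarrow> 'n"
    and A :: "'n \<Rightarrow> 'n \<Rightarrow> real"
    and b :: "'n \<Rightarrow> real"
    and q :: "real ^ 'n"
    and F :: "real ^ 'n \<Rightarrow> real ^ 'n"
  assumes F_nth: "F x $ i = (if i \<in> Q then x $ lc i * x $ rc i else b i + (\<Sum>j\<in>UNIV. A i j * x $ j))"
    and A_nonneg: "0 \<le> A i j"
    and b_nonneg: "0 \<le> b i"
    and row_sum_le: "b i + (\<Sum>j\<in>UNIV. A i j) \<le> 1"
    and q_pos: "0 < q $ i"
    and q_less_1: "q $ i < 1"
    and q_fixed: "F q = q"
    and q_least: "0 \<le> y \<Longrightarrow> F y = y \<Longrightarrow> q \<le> y"
begin

lemma q_nonneg: "0 \<le> q"
  using q_pos by (simp add: less_eq_vec_def less_imp_le)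

lemma F_mono: "0 \<le> x \<Longrightarrow> x \<le> y \<Longrightarrow> F x \<le> F y"
  by (auto simp: less_eq_vec_def F_nth A_nonneg intro!: mult_mono sum_mono mult_left_mono
      intro: order_trans)

lemma F_nonneg: "0 \<le> x \<Longrightarrow> 0 \<le> F x"
  by (auto simp: less_eq_vec_def F_nth A_nonneg b_nonneg intro!: add_nonneg_nonneg sum_nonneg)

text \<open>Knaster-Tarski: the infimum \<open>u\<close> of the nonnegative prefixed points is
  itself a fixed point, so \<open>q \<le> u \<le> y\<close>.\<close>

lemma q_le_prefixed:
  assumes "0 \<le> y" "F y \<le> y"
  shows "q \<le> y"
proof -
  define Y where "Y = {y. 0 \<le> y \<and> F y \<le> y}"
  define u where "u = (\<chi> i. Inf ((\<lambda>y. y $ i) ` Y))"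
  have yY: "y \<in> Y" using assms by (simp add: Y_def)
  have bdd: "bdd_below ((\<lambda>y. y $ i) ` Y)" for i
    by (rule bdd_belowI[of _ 0]) (auto simp: Y_def less_eq_vec_def)
  have lower: "u \<le> z" if "z \<in> Y" for z
    using that by (auto simp: less_eq_vec_def u_def intro: cInf_lower bdd)
  have greatest: "z \<le> u" if "\<And>t. t \<in> Y \<Longrightarrow> z \<le> t" for z
    unfolding less_eq_vec_def u_def
    using yY that by (auto simp: less_eq_vec_def intro!: cInf_greatest)
  have u0: "0 \<le> u" by (rule greatest) (simp add: Y_def)
  have Fu: "F u \<le> u"
  proof (rule greatest)
    fix t assume t: "t \<in> Y"
    then have "F u \<le> F t" by (intro F_mono u0 lower)
    also have "F t \<le> t" using t by (simp add: Y_def)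
    finally show "F u \<le> t" .
  qed
  have "F u \<in> Y" using u0 Fu by (simp add: Y_def F_nonneg F_mono)
  then have "u \<le> F u" by (rule lower)
  with Fu have "F u = u" by simp
  with u0 have "q \<le> u" by (rule q_least)
  also have "u \<le> y" by (rule lower[OF yY])
  finally show ?thesis .
qed

text \<open>Otherwise the variables in \<^term>\<open>T\<close> could be set to zero.\<close>

lemma no_trap:
  assumes "T \<noteq> {}"
    and quad: "\<And>i. i \<in> T \<Longrightarrow> i \<in> Q \<Longrightarrow> lc i \<in> T \<or> rc i \<in> T"
    and const: "\<And>i. i \<in> T \<Longrightarrow> i \<notin> Q \<Longrightarrow> b i = 0"
    and lin: "\<And>i j. i \<in> T \<Longrightarrow> i \<notin> Q \<Longrightarrow> 0 < A i j \<Longrightarrow> j \<in> T"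
  shows False
proof -
  define y where "y = (\<chi> i. if i \<in> T then 0 else q $ i)"
  have y: "0 \<le> y" "y \<le> q"
    using q_nonneg by (auto simp: y_def less_eq_vec_def)
  have "F y $ i \<le> y $ i" for i
  proof (cases "i \<in> T")
    case True
    have "F y $ i = 0"
    proof (cases "i \<in> Q")
      case q: True
      then show ?thesis using quad[OF True q] by (auto simp: F_nth y_def)
    next
      case nq: False
      have "A i j * y $ j = 0" for j
        using lin[OF True nq, of j] A_nonneg[of i j] by (cases "A i j = 0") (auto simp: y_def)
      then show ?thesis using const[OF True nq] nq by (simp add: F_nth sum.neutral del: mult_eq_0_iff)
    qed
    then show ?thesis using y by (simp add: less_eq_vec_def)
  next
    case False
    then show ?thesis using F_mono[OF y] q_fixed by (simp add: less_eq_vec_def y_def)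
  qed
  then have "q \<le> y" using y by (intro q_le_prefixed) (auto simp: less_eq_vec_def)
  moreover obtain i where "i \<in> T" using assms(1) by blast
  ultimately show False using q_pos[of i] by (auto simp: less_eq_vec_def y_def dest!: spec[of _ i])
qed

section \<open>The complement of the fixed point and the Jacobian\<close>

definition v :: "real ^ 'n" where "v = 1 - q"

lemma v_nth: "v $ i = 1 - q $ i" by (simp add: v_def)

lemma v_pos: "0 < v $ i" and v_less_1: "v $ i < 1"
  using q_pos q_less_1 by (simp_all add: v_nth)

text \<open>The constant term that a linear row acquires when it is rewritten for \<open>v\<close>,
  see \<open>v_lin\<close>.\<close>

definition leak :: "'n \<Rightarrow> real" where "leak i = 1 - b i - (\<Sum>j\<in>UNIV. A i j)"

lemma leak_nonneg: "0 \<le> leak i"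
  using row_sum_le[of i] by (simp add: leak_def)

lemma q_nth: "q $ i = (if i \<in> Q then q $ lc i * q $ rc i else b i + (\<Sum>j\<in>UNIV. A i j * q $ j))"
  using F_nth[of q i] q_fixed by simp

lemma v_quad: "i \<in> Q \<Longrightarrow> v $ i = v $ lc i + v $ rc i - v $ lc i * v $ rc i"
  using q_nth[of i] by (simp add: v_nth algebra_simps)

lemma v_lin: "i \<notin> Q \<Longrightarrow> v $ i = leak i + (\<Sum>j\<in>UNIV. A i j * v $ j)"
  using q_nth[of i] by (simp add: v_nth leak_def algebra_simps sum_subtractf)

text \<open>The Jacobian of \<open>F\<close>, as \<open>jacobian_F\<close> confirms. The two
  indicators are added, so that coinciding children give the derivative of a square.\<close>

definition B :: "real ^ 'n \<Rightarrow> real ^ 'n ^ 'n" where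
  "B x = (\<chi> i j. if i \<in> Q then x $ rc i * of_bool (j = lc i) + x $ lc i * of_bool (j = rc i) else A i j)"

lemma B_mult_nth:
  "(B x *v d) $ i = (if i \<in> Q then x $ rc i * d $ lc i + x $ lc i * d $ rc i else (\<Sum>j\<in>UNIV. A i j * d $ j))"
  by (simp add: B_def matrix_vector_mult_def distrib_right sum.distrib mult.assoc
      of_bool_def if_distrib[of "\<lambda>t. _ * t"] if_distrib[of "\<lambda>t. t * _"] cong: if_cong)

text \<open>The expansion is exact because \<open>F\<close> has degree at most two.\<close>

lemma F_taylor:
  "F (x + d) $ i = F x $ i + (B x *v d) $ i + (if i \<in> Q then d $ lc i * d $ rc i else 0)"
  by (simp add: F_nth B_mult_nth algebra_simps sum.distrib)

text \<open>The criterion is applied with the vector \<open>v\<close>. Quadratic rows are strict by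
  at least \<open>v $ lc i * v $ rc i\<close> and linear rows fall short by \<open>leak i\<close>,
  so a tight closed set has only linear rows without leak, and such a set would contain a
  trap.\<close>

lemma B_inverse_positive:
  assumes x: "0 \<le> x" "x \<le> q"
  shows "inverse_positive (B x)"
proof (rule inverse_positive_criterion[where v = v])
  have x': "0 \<le> x $ i" "x $ i \<le> q $ i" for i
    using x by (auto simp: less_eq_vec_def)
  show "0 \<le> B x $ i $ j" for i j
    using x' by (simp add: B_def A_nonneg)
  show "0 < v $ i" for i by (rule v_pos)
  have quad: "(B x *v v) $ i < v $ i" if "i \<in> Q" for i
  proof -
    have "(B x *v v) $ i \<le> q $ rc i * v $ lc i + q $ lc i * v $ rc i"
      using that x' v_pos by (simp add: B_mult_nth add_mono mult_right_mono less_imp_le)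
    also have "\<dots> = v $ i - v $ lc i * v $ rc i"
      using v_quad[OF that] by (simp add: v_nth algebra_simps)
    also have "\<dots> < v $ i" using v_pos by simp
    finally show ?thesis .
  qed
  have lin: "(B x *v v) $ i = v $ i - leak i" if "i \<notin> Q" for i
    using that v_lin[OF that] by (simp add: B_mult_nth)
  show "B x *v v \<le> v"
    unfolding less_eq_vec_def
  proof
    fix i show "(B x *v v) $ i \<le> v $ i"
      using quad[of i] lin[of i] leak_nonneg[of i] by (cases "i \<in> Q") auto
  qed
  fix T assume ne: "T \<noteq> {}"
    and tight: "\<And>i. i \<in> T \<Longrightarrow> (B x *v v) $ i = v $ i"
    and closed: "\<And>i j. i \<in> T \<Longrightarrow> 0 < B x $ i $ j \<Longrightarrow> j \<in> T"
  have TQ: "i \<notin> Q" if "i \<in> T" for i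
    using quad[of i] tight[OF that] by auto
  have T_leak: "leak i = 0" if "i \<in> T" for i
    using lin[OF TQ[OF that]] tight[OF that] by simp
  have closed': "j \<in> T" if "i \<in> T" "0 < A i j" for i j
    using closed[OF that(1), of j] TQ[OF that(1)] that(2) by (simp add: B_def)
  define m where "m = Max ((\<lambda>i. v $ i) ` T)"
  have m_ge: "v $ i \<le> m" if "i \<in> T" for i
    unfolding m_def using that by (intro Max_ge) auto
  have "m \<in> (\<lambda>i. v $ i) ` T"
    unfolding m_def using ne by (intro Max_in) auto
  then obtain i0 where i0: "i0 \<in> T" "v $ i0 = m" by auto
  then have m_pos: "0 < m" using v_pos by auto
  \<comment> \<open>Maximum principle: in a row of \<open>U\<close> the value \<open>m\<close>
    equals a weighted sum of values at most \<open>m\<close> with total weight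
    \<open>1 - b i\<close>. Hence \<open>b i = 0\<close> and all dependencies attain the maximum
    too.\<close>
  define U where "U = {i \<in> T. v $ i = m}"
  have U: "b i = 0 \<and> (\<forall>j. A i j * (m - v $ j) = 0)" if "i \<in> U" for i
  proof -
    have iT: "i \<in> T" and vi: "v $ i = m" using that by (auto simp: U_def)
    have nn: "0 \<le> A i j * (m - v $ j)" for j
      using closed'[OF iT, of j] m_ge[of j] A_nonneg[of i j]
      by (cases "A i j = 0") auto
    have "(\<Sum>j\<in>UNIV. A i j * (m - v $ j)) = (\<Sum>j\<in>UNIV. A i j) * m - (\<Sum>j\<in>UNIV. A i j * v $ j)"
      by (simp add: right_diff_distrib sum_subtractf sum_distrib_right)
    also have "(\<Sum>j\<in>UNIV. A i j * v $ j) = m"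
      using v_lin[OF TQ[OF iT]] T_leak[OF iT] vi by simp
    also have "(\<Sum>j\<in>UNIV. A i j) = 1 - b i"
      using T_leak[OF iT] by (simp add: leak_def)
    finally have eq: "(\<Sum>j\<in>UNIV. A i j * (m - v $ j)) + b i * m = 0"
      by (simp add: algebra_simps)
    have "0 \<le> (\<Sum>j\<in>UNIV. A i j * (m - v $ j))" by (intro sum_nonneg nn)
    moreover have "0 \<le> b i * m" using b_nonneg m_pos by simp
    ultimately have "b i * m = 0" "(\<Sum>j\<in>UNIV. A i j * (m - v $ j)) = 0"
      using eq by linarith+
    then show ?thesis
      using nn m_pos by (subst (asm) sum_nonneg_eq_0_iff) auto
  qed
  show False
  proof (rule no_trap[of U])
    show "U \<noteq> {}" using i0 by (auto simp: U_def)
    show "b i = 0" if "i \<in> U" for i using U[OF that] by simp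
    show "j \<in> U" if "i \<in> U" "0 < A i j" for i j
    proof -
      have "A i j * (m - v $ j) = 0" using U[OF that(1)] by blast
      then have "v $ j = m" using that(2) by simp
      moreover have "j \<in> T" using closed' that by (auto simp: U_def)
      ultimately show ?thesis by (simp add: U_def)
    qed
    show "lc i \<in> U \<or> rc i \<in> U" if "i \<in> U" "i \<in> Q" for i
      using TQ that by (auto simp: U_def)
  qed
qed

section \<open>Halving of the error by a Newton step\<close>

text \<open>The step \<open>d\<close> solves \<open>d - B x *v d = F x - x\<close>. Apart from
  \<open>N \<le> F N\<close>, each claim follows by exhibiting a vector \<open>z\<close> with
  \<open>B x *v z \<le> z\<close>.\<close>

lemma newton_step:
  assumes x: "0 \<le> x" "x \<le> q" "x \<le> F x"
    and err: "q - x \<le> t *s v"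
    and N: "N = x + matrix_inv (mat 1 - B x) *v (F x - x)"
  shows "0 \<le> N" "N \<le> q" "N \<le> F N" "q - N \<le> (t / 2) *s v"
proof -
  have ip: "inverse_positive (B x)" by (rule B_inverse_positive[OF x(1,2)])
  have inv: "invertible (mat 1 - B x)" by (rule inverse_positive_invertible[OF ip])
  define d where "d = N - x"
  define e where "e = q - x"
  have N_eq: "N = x + d" by (simp add: d_def)
  have "(mat 1 - B x) *v d = (mat 1 - B x) ** matrix_inv (mat 1 - B x) *v (F x - x)"
    unfolding d_def N by (simp add: matrix_vector_mul_assoc)
  also have "\<dots> = F x - x" using inv by (simp add: matrix_inv_mult)
  finally have d: "d - B x *v d = F x - x"
    by (simp add: matrix_vector_mult_diff_rdistrib)
  have d_nth: "(B x *v d) $ i = d $ i - F x $ i + x $ i" for i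
    using arg_cong[OF d, of "\<lambda>z. z $ i"] by simp
  have d0: "0 \<le> d"
    by (rule inverse_positiveD[OF ip]) (use x(3) d_nth in \<open>simp add: less_eq_vec_def\<close>)
  then show "0 \<le> N" using x(1) N_eq by simp
  have d0': "0 \<le> d $ i" for i using d0 by (simp add: less_eq_vec_def)
  \<comment> \<open>The linearization of \<open>F\<close> at \<open>x\<close> takes the value
    \<open>N\<close> at \<open>N\<close>, so \<open>F N - N\<close> is just the quadratic term of
    the expansion.\<close>
  show "N \<le> F N"
    unfolding N_eq less_eq_vec_def by (simp add: F_taylor d_nth d0')
  have e0: "0 \<le> e $ i" and e_le: "e $ i \<le> t * v $ i" for i
    using x(2) err by (auto simp: e_def less_eq_vec_def)
  have Be: "(B x *v e) $ i = q $ i - F x $ i - (if i \<in> Q then e $ lc i * e $ rc i else 0)" for i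
    using F_taylor[of x e i] q_fixed by (simp add: e_def)
  have qN: "q - N = e - d" by (simp add: e_def d_def)
  \<comment> \<open>Thus \<open>I - B x\<close> maps the new error to the quadratic remainder of the
    old error \<open>e\<close>.\<close>
  have BqN: "(B x *v (q - N)) $ i = (q - N) $ i - (if i \<in> Q then e $ lc i * e $ rc i else 0)" for i
    by (simp add: qN matrix_vector_mult_diff_distrib Be d_nth) (simp add: e_def)
  have "0 \<le> q - N"
    by (rule inverse_positiveD[OF ip]) (unfold less_eq_vec_def, simp only: BqN, simp add: e0)
  then show "N \<le> q" by simp
  \<comment> \<open>In a quadratic row \<open>v - B x *v v\<close> contains two mixed products of
    \<open>e\<close> and \<open>v\<close>. By \<open>e \<le> t v\<close>, \<open>t\<close> times
    each is at least \<open>e $ lc i * e $ rc i\<close>; having two of them pays for the factor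
    1/2.\<close>
  have slack: "(t / 2) * (B x *v v) $ i \<le> (t / 2) * v $ i - (if i \<in> Q then e $ lc i * e $ rc i else 0)" for i
  proof (cases "i \<in> Q")
    case True
    let ?a = "v $ lc i" and ?b = "v $ rc i" and ?c = "e $ lc i" and ?d = "e $ rc i"
    have t: "0 \<le> t"
    proof -
      have "0 \<le> t * v $ i" using e0[of i] e_le[of i] by simp
      then show ?thesis using v_pos[of i] by (simp add: zero_le_mult_iff)
    qed
    have "v $ i - (B x *v v) $ i = ?c * ?b + ?d * ?a + ?a * ?b"
      using True by (simp add: q_nth[of i] B_mult_nth e_def v_nth algebra_simps)
    then have "(t / 2) * (v $ i - (B x *v v) $ i) = (?c * (t * ?b) + ?d * (t * ?a) + t * (?a * ?b)) / 2"
      by (simp add: algebra_simps)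
    moreover have "?c * ?d \<le> ?c * (t * ?b)" "?d * ?c \<le> ?d * (t * ?a)"
      by (intro mult_left_mono e_le e0)+
    moreover have "0 \<le> t * (?a * ?b)" using t v_pos by (simp add: less_imp_le)
    ultimately have "(t / 2) * (v $ i - (B x *v v) $ i) \<ge> ?c * ?d"
      by (simp add: mult.commute)
    then show ?thesis using True by (simp add: algebra_simps)
  next
    case False
    have t: "0 \<le> t"
    proof -
      have "0 \<le> t * v $ i" using e0[of i] e_le[of i] by simp
      then show ?thesis using v_pos[of i] by (simp add: zero_le_mult_iff)
    qed
    have "(B x *v v) $ i \<le> v $ i" using False leak_nonneg[of i] by (simp add: B_mult_nth v_lin)
    then show ?thesis using False t by (simp add: mult_left_mono)
  qed
  have "0 \<le> (t / 2) *s v - (q - N)"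
  proof (rule inverse_positiveD[OF ip], unfold less_eq_vec_def, rule allI)
    fix i
    have "(B x *v ((t / 2) *s v - (q - N))) $ i = (t / 2) * (B x *v v) $ i - (B x *v (q - N)) $ i"
      by (simp add: matrix_vector_mult_diff_distrib vector_scalar_commute)
    also have "\<dots> \<le> ((t / 2) *s v - (q - N)) $ i"
      using slack[of i] BqN[of i] by simp
    finally show "(B x *v ((t / 2) *s v - (q - N))) $ i \<le> ((t / 2) *s v - (q - N)) $ i" .
  qed
  then show "q - N \<le> (t / 2) *s v" by simp
qed

lemma jacobian_F: "jacobian F (at x) = B x"
proof -
  have nth: "((\<lambda>x. x $ j) has_derivative (\<lambda>h. h $ j)) (at x)" for j
    by (rule bounded_linear_imp_has_derivative[OF bounded_linear_vec_nth])
  have comp: "((\<lambda>x. F x $ i) has_derivative (\<lambda>h. (B x *v h) $ i)) (at x)" for i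
  proof (cases "i \<in> Q")
    case True
    then show ?thesis
      by (auto simp: F_nth B_mult_nth mult_ac intro!: derivative_eq_intros nth)
  next
    case False
    then show ?thesis
      by (auto simp: F_nth B_mult_nth intro!: derivative_eq_intros nth)
  qed
  have "(F has_derivative (\<lambda>h. B x *v h)) (at x)"
    by (subst has_derivative_componentwise_within) (auto simp: Basis_vec_def inner_axis comp)
  then have "frechet_derivative F (at x) = (\<lambda>h. B x *v h)"
    by (rule frechet_derivative_at[symmetric])
  then show ?thesis by (simp add: jacobian_def)
qed

lemma newton_sequence:
  assumes x: "x 0 = 0" "\<And>k. x (Suc k) = x k + matrix_inv (mat 1 - B (x k)) *v (F (x k) - x k)"
    and t: "q \<le> t *s v"
  shows "0 \<le> x k \<and> x k \<le> q \<and> x k \<le> F (x k) \<and> q - x k \<le> (t / 2 ^ k) *s v"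
proof (induction k)
  case 0
  then show ?case using t q_nonneg F_nonneg[of 0] by (simp add: x)
next
  case (Suc k)
  then show ?case
    using newton_step[of "x k" "t / 2 ^ k" "x (Suc k)"] x(2)[of k] by (simp add: field_simps)
qed

section \<open>The dependency graph and the truncated matrices on closed sets\<close>

definition edges :: "('n \<times> 'n) set" where
  "edges = {(i, j). if i \<in> Q then j = lc i \<or> j = rc i else 0 < A i j}"

lemma edges_quad: "i \<in> Q \<Longrightarrow> (i, lc i) \<in> edges" "i \<in> Q \<Longrightarrow> (i, rc i) \<in> edges"
  and edges_lin: "i \<notin> Q \<Longrightarrow> 0 < A i j \<Longrightarrow> (i, j) \<in> edges"
  by (auto simp: edges_def)

lemma leak_le_v: "i \<notin> Q \<Longrightarrow> leak i \<le> v $ i"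
  using v_pos A_nonneg by (simp add: v_lin sum_nonneg less_imp_le)

lemma child_le_quad:
  assumes "i \<in> Q"
  shows "v $ lc i \<le> v $ i" "v $ rc i \<le> v $ i"
proof -
  have "v $ i = v $ lc i + v $ rc i * q $ lc i" "v $ i = v $ rc i + v $ lc i * q $ rc i"
    using v_quad[OF assms] by (simp_all add: v_nth algebra_simps)
  then show "v $ lc i \<le> v $ i" "v $ rc i \<le> v $ i"
    using mult_pos_pos[OF v_pos q_pos] by (metis add_increasing2 less_imp_le order_refl)+
qed

text \<open>For closed \<^term>\<open>C\<close> this interpolates between a substochastic matrix (\<^term>\<open>S = {}\<close>) and the
  Jacobian matrix on \<^term>\<open>C\<close> at the point 1 (\<^term>\<open>S = C \<inter> Q\<close>).\<close>

definition partial_matrix :: "'n set \<Rightarrow> 'n set \<Rightarrow> real ^ 'n ^ 'n" where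
  "partial_matrix C S = (\<chi> i j.
     if i \<in> C then if i \<in> Q then of_bool (j = lc i) + of_bool (i \<in> S \<and> j = rc i) else A i j else 0)"

lemma partial_matrix_mult_nth:
  "(partial_matrix C S *v z) $ i =
     (if i \<in> C then if i \<in> Q then z $ lc i + (if i \<in> S then z $ rc i else 0)
        else (\<Sum>j\<in>UNIV. A i j * z $ j) else 0)"
  by (simp add: partial_matrix_def matrix_vector_mult_def distrib_right sum.distrib
      of_bool_def if_distrib[of "\<lambda>t. t * _"] cong: if_cong)

text \<open>With one child per quadratic row all row sums are at most 1, so the criterion applies
  with the all-ones vector; a tight closed set would be a trap, since it contains the kept child of
  each of its quadratic rows.\<close>

lemma partial_matrix_empty_inverse_positive: "inverse_positive (partial_matrix C {})"
proof (rule inverse_positive_criterion[where v = 1])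
  show "0 \<le> partial_matrix C {} $ i $ j" for i j
    by (simp add: partial_matrix_def A_nonneg)
  show "0 < (1 :: real ^ 'n) $ i" for i by simp
  have sumA: "(\<Sum>j\<in>UNIV. A i j) \<le> 1 - b i" for i
    using row_sum_le[of i] by simp
  show "partial_matrix C {} *v 1 \<le> 1"
    unfolding less_eq_vec_def
  proof
    fix i show "(partial_matrix C {} *v 1) $ i \<le> 1 $ i"
      using sumA[of i] b_nonneg[of i] by (simp add: partial_matrix_mult_nth)
  qed
  fix T assume ne: "T \<noteq> {}"
    and tight: "\<And>i. i \<in> T \<Longrightarrow> (partial_matrix C {} *v 1) $ i = 1 $ i"
    and closed: "\<And>i j. i \<in> T \<Longrightarrow> 0 < partial_matrix C {} $ i $ j \<Longrightarrow> j \<in> T"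
  have TC: "i \<in> C" if "i \<in> T" for i
    using tight[OF that] by (cases "i \<in> C") (auto simp: partial_matrix_mult_nth)
  show False
  proof (rule no_trap[OF ne])
    show "lc i \<in> T \<or> rc i \<in> T" if "i \<in> T" "i \<in> Q" for i
      using closed[OF that(1), of "lc i"] that TC[of i] by (simp add: partial_matrix_def)
    show "b i = 0" if "i \<in> T" "i \<notin> Q" for i
      using tight[OF that(1)] that TC[of i] sumA[of i] b_nonneg[of i]
      by (simp add: partial_matrix_mult_nth)
    show "j \<in> T" if "i \<in> T" "i \<notin> Q" "0 < A i j" for i j
      using closed[OF that(1), of j] that TC[of i] by (simp add: partial_matrix_def)
  qed
qed

end

section \<open>Lower bounds for \<open>v\<close> from integrality\<close>

locale snf_denominators = snf +
  fixes d :: "'a \<Rightarrow> nat"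
  assumes d_ge_1: "1 \<le> d i"
    and d_A: "i \<notin> Q \<Longrightarrow> real (d i) * A i j \<in> \<int>"
    and d_b: "i \<notin> Q \<Longrightarrow> real (d i) * b i \<in> \<int>"
begin

definition D :: real where "D = (\<Prod>i\<in>UNIV. real (d i))"

lemma D_ge_1: "1 \<le> D"
  unfolding D_def using d_ge_1 by (intro prod_ge_1) simp

text \<open>A positive coefficient of row \<open>i\<close> is at least \<open>1 / d i\<close> by
  integrality; a quadratic row dominates both of its children outright.\<close>

lemma edge_lower_bound:
  assumes "(i, j) \<in> edges"
  shows "v $ j / d i \<le> v $ i"
proof (cases "i \<in> Q")
  case True
  have "v $ j / d i \<le> v $ j"
    using d_ge_1[of i] v_pos[of j] by (simp add: divide_le_eq)
  also have "\<dots> \<le> v $ i"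
    using assms True child_le_quad[OF True] by (auto simp: edges_def)
  finally show ?thesis .
next
  case False
  then have "0 < A i j" using assms by (simp add: edges_def)
  then have "1 \<le> d i * A i j" using d_A[OF False, of j] d_ge_1[of i] by (intro pos_Ints_ge_1) auto
  then have "1 * v $ j \<le> (d i * A i j) * v $ j" using v_pos by (intro mult_right_mono) (auto simp: less_imp_le)
  then have "v $ j / d i \<le> A i j * v $ j"
    using d_ge_1[of i] by (simp add: divide_le_eq mult_ac)
  also have "\<dots> \<le> (\<Sum>j\<in>UNIV. A i j * v $ j)"
    using A_nonneg v_pos by (intro member_le_sum) (auto simp: less_imp_le)
  also have "\<dots> \<le> v $ i" using v_lin[OF False] leak_nonneg[of i] by simp
  finally show ?thesis .
qed

text \<open>The set \<^term>\<open>T\<close> in the proof collects the distinct variables of a path, so that each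
  denominator is paid at most once.\<close>

lemma path_lower_bound:
  assumes path: "(i, m) \<in> edges\<^sup>*" and "0 < \<theta>" and m: "\<theta> / d m \<le> v $ m"
  shows "\<theta> / D \<le> v $ i"
proof -
  have "\<exists>T. i \<in> T \<and> (\<forall>t\<in>T. \<theta> / (\<Prod>s\<in>T. real (d s)) \<le> v $ t)"
    using path
  proof (induction rule: converse_rtrancl_induct)
    case base
    show ?case using m by (intro exI[of _ "{m}"]) simp
  next
    case (step i j)
    then obtain T where T: "j \<in> T" "\<And>t. t \<in> T \<Longrightarrow> \<theta> / (\<Prod>s\<in>T. real (d s)) \<le> v $ t" by blast
    show ?case
    proof (cases "i \<in> T")
      case True
      with T show ?thesis by blast
    next
      case False
      let ?p = "\<Prod>s\<in>T. real (d s)"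
      have p: "1 \<le> ?p" using d_ge_1 by (intro prod_ge_1) simp
      have di: "1 \<le> real (d i)" using d_ge_1[of i] by simp
      have eq: "\<theta> / (\<Prod>s\<in>insert i T. real (d s)) = \<theta> / ?p / d i"
        using False by (simp add: mult.commute)
      have "\<theta> / ?p / d i \<le> v $ t" if "t \<in> insert i T" for t
      proof (cases "t = i")
        case True
        have "\<theta> / ?p / d i \<le> v $ j / d i" using T di by (intro divide_right_mono) auto
        also have "\<dots> \<le> v $ i" by (rule edge_lower_bound[OF step.hyps(1)])
        finally show ?thesis using True by simp
      next
        case False
        have "\<theta> / ?p / d i \<le> \<theta> / ?p / 1"
          using di p \<open>0 < \<theta>\<close> by (intro divide_left_mono) auto
        also have "\<dots> \<le> v $ t" using T(2)[of t] that False by simp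
        finally show ?thesis .
      qed
      then show ?thesis unfolding eq[symmetric] by (intro exI[of _ "insert i T"]) simp
    qed
  qed
  then obtain T where T: "i \<in> T" "\<And>t. t \<in> T \<Longrightarrow> \<theta> / (\<Prod>s\<in>T. real (d s)) \<le> v $ t" by blast
  have "(\<Prod>s\<in>T. real (d s)) \<le> D"
    unfolding D_def using d_ge_1 by (intro prod_mono2) (auto intro: order_trans[of 0 1])
  moreover have "1 \<le> (\<Prod>s\<in>T. real (d s))" using d_ge_1 by (intro prod_ge_1) simp
  ultimately have "\<theta> / D \<le> \<theta> / (\<Prod>s\<in>T. real (d s))"
    using \<open>0 < \<theta>\<close> by (intro divide_left_mono) auto
  also have "\<dots> \<le> v $ i" using T by blast
  finally show ?thesis .
qed

text \<open>By integrality a nonzero leak is at least \<open>1 / d m\<close>, which already pays for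
  the last row of the path.\<close>

lemma leak_lower_bound:
  assumes "(i, m) \<in> edges\<^sup>*" "m \<notin> Q" "leak m \<noteq> 0"
  shows "1 / D \<le> v $ i"
proof (rule path_lower_bound[OF assms(1)])
  have "d m * leak m = d m - d m * b m - (\<Sum>j\<in>UNIV. d m * A m j)"
    by (simp add: leak_def right_diff_distrib sum_distrib_left)
  also have "\<dots> \<in> \<int>" using d_A d_b assms(2) by (intro Ints_diff Ints_sum) auto
  finally have "1 \<le> d m * leak m"
    using assms(3) leak_nonneg[of m] d_ge_1[of m] by (intro pos_Ints_ge_1) auto
  then have "1 / d m \<le> leak m" using d_ge_1[of m] by (simp add: divide_le_eq mult.commute)
  then show "1 / d m \<le> v $ m" using leak_le_v[OF assms(2)] by simp
qed simp

text \<open>By Cramer's rule; \<^term>\<open>\<Delta>\<close> is the determinant and \<^term>\<open>N\<close> consists of the cofactors.\<close>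

lemma partial_matrix_inverse_entries:
  assumes ip: "inverse_positive (partial_matrix C S)"
  defines "M \<equiv> partial_matrix C S"
  obtains G :: "real ^ 'a ^ 'a" and N \<Delta>
  where "G ** (mat 1 - M) = mat 1" "(mat 1 - M) ** G = mat 1"
    and "0 < \<bar>\<Delta>\<bar>" "\<And>k l. G $ k $ l * \<Delta> = N k l"
    and "\<And>k l. D * N k l \<in> \<int>" "D * \<Delta> \<in> \<int>"
    and "\<And>k l. \<bar>N k l\<bar> \<le> 4 ^ CARD('a)"
proof -
  let ?I = "mat 1 - M"
  define G where "G = matrix_inv ?I"
  define N where "N k l = det (\<chi> i j. if j = k then axis l 1 $ i else ?I $ i $ j)" for k l
  have inv: "invertible ?I"
    unfolding M_def by (rule inverse_positive_invertible[OF ip])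
  have G: "?I ** G = mat 1" "G ** ?I = mat 1"
    using matrix_inv_mult[OF inv] by (simp_all add: G_def)
  have col: "?I *v column l G = axis l 1" for l
    using G(1) by (simp add: matrix_vector_mult_def column_def matrix_matrix_mult_def vec_eq_iff mat_def axis_def)
  have GN: "G $ k $ l * det ?I = N k l" for k l
    using cramer_lemma[where A = ?I and x = "column l G" and k = k]
    unfolding col by (simp add: N_def column_def)
  have entry_Ints: "real (d i) * ?I $ i $ j \<in> \<int>" for i j
    using d_A[of i j] by (auto simp: M_def partial_matrix_def mat_def right_diff_distrib intro!: Ints_diff)
  have N_Ints: "D * N k l \<in> \<int>" for k l
    unfolding N_def D_def
    by (rule row_scaled_det_Ints) (use entry_Ints in \<open>auto simp: axis_def\<close>)
  have \<Delta>_Ints: "D * det ?I \<in> \<int>"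
    unfolding D_def by (rule row_scaled_det_Ints) (rule entry_Ints)
  have M0: "0 \<le> M $ i $ j" for i j by (simp add: M_def partial_matrix_def A_nonneg)
  have M_row: "(\<Sum>j\<in>UNIV. M $ i $ j) \<le> 2" for i
  proof -
    have "(\<Sum>j\<in>UNIV. M $ i $ j) = (M *v 1) $ i" by (simp add: matrix_vector_mult_def)
    also have "\<dots> \<le> 2"
      using row_sum_le[of i] b_nonneg[of i] by (simp add: M_def partial_matrix_mult_nth)
    finally show ?thesis .
  qed
  have "\<bar>N k l\<bar> \<le> 4 ^ CARD('a)" for k l
  proof -
    \<comment> \<open>The identity and the replaced column contribute at most 1 each, the row of
      \<open>M\<close> at most 2.\<close>
    have row: "(\<Sum>j\<in>UNIV. \<bar>(\<chi> i j. if j = k then axis l 1 $ i else ?I $ i $ j) $ i $ j\<bar>) \<le> 4" for i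
    proof -
      have "(\<Sum>j\<in>UNIV. \<bar>(\<chi> i j. if j = k then axis l 1 $ i else ?I $ i $ j) $ i $ j\<bar>)
        \<le> (\<Sum>j\<in>UNIV. of_bool (j = k) + of_bool (j = i) + M $ i $ j)"
        using M0 by (intro sum_mono) (auto simp: axis_def mat_def abs_le_iff)
      also have "\<dots> = 2 + (\<Sum>j\<in>UNIV. M $ i $ j)"
        by (simp add: sum.distrib of_bool_def)
      also have "\<dots> \<le> 4" using M_row[of i] by simp
      finally show ?thesis .
    qed
    have "\<bar>N k l\<bar> \<le> (\<Prod>i\<in>(UNIV :: 'a set). 4)"
      unfolding N_def by (rule order_trans[OF abs_det_le_prod_row_sums])
        (intro prod_mono conjI sum_nonneg row abs_ge_zero)
    then show ?thesis by simp
  qed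
  moreover have "0 < \<bar>det ?I\<bar>" using inv by (simp add: invertible_det_nz)
  ultimately show ?thesis using that G GN N_Ints \<Delta>_Ints by blast
qed

text \<open>A maximal set \<^term>\<open>S\<close> of quadratic rows for which \<^term>\<open>partial_matrix C S\<close> is
  subcritical is proper, since otherwise \<^term>\<open>v\<close> restricted to \<^term>\<open>C\<close> would be nonpositive.\<close>

lemma maximal_subcritical:
  assumes "C \<noteq> {}"
    and closed_set: "edges `` C \<subseteq> C"
    and no_leak: "\<forall>i\<in>C - Q. leak i = 0"
  obtains S i where "S \<subseteq> C \<inter> Q" "i \<in> C \<inter> Q" "i \<notin> S"
    "inverse_positive (partial_matrix C S)" "\<not> inverse_positive (partial_matrix C (insert i S))"
proof -
  have closed: "j \<in> C" if "i \<in> C" "(i, j) \<in> edges" for i j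
    using closed_set that by blast
  define \<S> where "\<S> = {S \<in> Pow (C \<inter> Q). inverse_positive (partial_matrix C S)}"
  have "finite \<S>" "{} \<in> \<S>"
    using partial_matrix_empty_inverse_positive by (simp_all add: \<S>_def)
  then obtain S where "S \<in> \<S>" and max: "\<forall>S'\<in>\<S>. S \<subseteq> S' \<longrightarrow> S = S'"
    using finite_has_maximal[of \<S>] by blast
  then have S: "S \<subseteq> C \<inter> Q" "inverse_positive (partial_matrix C S)"
    by (simp_all add: \<S>_def)
  have "S \<noteq> C \<inter> Q"
  proof
    assume eq: "S = C \<inter> Q"
    \<comment> \<open>With both children kept, \<open>v_quad\<close> makes \<open>v\<close> at most
      its image in quadratic rows, with equality in linear rows for lack of leak; closedness of
      \<open>C\<close> makes the zeros outside harmless.\<close>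
    define z where "z = (\<chi> i. if i \<in> C then - v $ i else 0)"
    have "0 \<le> z"
    proof (rule inverse_positiveD)
      show "inverse_positive (partial_matrix C S)" by (rule S(2))
      have "(partial_matrix C S *v z) $ i \<le> z $ i" for i
      proof -
        consider "i \<notin> C" | "i \<in> C" "i \<in> Q" | "i \<in> C" "i \<notin> Q" by blast
        then show ?thesis
        proof cases
          case 1
          then show ?thesis by (simp add: partial_matrix_mult_nth z_def)
        next
          case 2
          then have "lc i \<in> C" "rc i \<in> C" using closed edges_quad by blast+
          then show ?thesis
            using 2 eq v_quad[of i] v_pos[of "lc i"] v_pos[of "rc i"]
            by (simp add: partial_matrix_mult_nth z_def)
        next
          case 3
          have "A i j * z $ j = - (A i j * v $ j)" for j
            using closed[OF 3(1) edges_lin[OF 3(2)], of j] A_nonneg[of i j]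
            by (cases "A i j = 0") (auto simp: z_def)
          then show ?thesis
            using 3 v_lin[of i] no_leak by (simp add: partial_matrix_mult_nth sum_negf z_def)
        qed
      qed
      then show "partial_matrix C S *v z \<le> z" by (simp add: less_eq_vec_def)
    qed
    moreover obtain i where "i \<in> C" using \<open>C \<noteq> {}\<close> by blast
    ultimately have "0 \<le> - v $ i"
      unfolding less_eq_vec_def z_def by (auto dest: spec[of _ i])
    then show False using v_pos[of i] by simp
  qed
  then obtain i where i: "i \<in> C \<inter> Q" "i \<notin> S" using S(1) by blast
  have "insert i S \<notin> \<S>" using max i(2) by blast
  then have "\<not> inverse_positive (partial_matrix C (insert i S))"
    using S(1) i(1) by (simp add: \<S>_def)
  then show ?thesis by (rule that[OF S(1) i S(2)])
qed

text \<open>Applying the inverse \<open>G\<close> to the residual of \<open>v\<close> on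
  \<open>C\<close> equates a sum quadratic in \<open>v\<close> with a nonnegative combination linear
  in \<open>v\<close> (\<open>balance\<close>). After clearing denominators the former is at most a
  constant times the square of the maximum and the latter at least a constant times the maximum;
  dividing by the maximum gives the bound.\<close>

lemma scc_max_lower_bound:
  assumes closed_set: "edges `` C \<subseteq> C"
    and connected: "\<And>i j. i \<in> C \<Longrightarrow> j \<in> C \<Longrightarrow> (i, j) \<in> edges\<^sup>*"
    and no_leak: "\<forall>i\<in>C - Q. leak i = 0"
    and a: "a \<in> C" "\<And>i. i \<in> C \<Longrightarrow> v $ i \<le> v $ a"
  shows "1 \<le> 8 ^ CARD('a) * D\<^sup>2 * v $ a"
proof -
  have closed: "j \<in> C" if "i \<in> C" "(i, j) \<in> edges" for i j
    using closed_set that by blast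
  have "C \<noteq> {}" using a by auto
  from maximal_subcritical[OF this closed_set no_leak]
  obtain S i where S: "S \<subseteq> C \<inter> Q" and i: "i \<in> C \<inter> Q" "i \<notin> S"
    and ip: "inverse_positive (partial_matrix C S)"
    and not_ip: "\<not> inverse_positive (partial_matrix C (insert i S))"
    by metis
  define M where "M = partial_matrix C S"
  have ip: "inverse_positive M" using ip by (simp add: M_def)
  obtain G :: "real ^ 'a ^ 'a" and N \<Delta>
    where G: "G ** (mat 1 - M) = mat 1" "(mat 1 - M) ** G = mat 1"
      and \<Delta>: "0 < \<bar>\<Delta>\<bar>" and GN: "\<And>k l. G $ k $ l * \<Delta> = N k l"
      and N_Ints: "\<And>k l. D * N k l \<in> \<int>" and \<Delta>_Ints: "D * \<Delta> \<in> \<int>"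
      and N_le: "\<And>k l. \<bar>N k l\<bar> \<le> 4 ^ CARD('a)"
    using partial_matrix_inverse_entries[OF ip[unfolded M_def], folded M_def] by metis
  have col: "M *v column l G = column l G - axis l 1" for l
  proof -
    have "(mat 1 - M) *v column l G = axis l 1"
      using G(2) by (simp add: matrix_vector_mult_def column_def matrix_matrix_mult_def vec_eq_iff mat_def axis_def)
    then show ?thesis by (simp add: matrix_vector_mult_diff_rdistrib algebra_simps)
  qed
  have col0: "0 \<le> column l G" for l
    by (rule inverse_positiveD[OF ip]) (simp add: col less_eq_vec_def axis_def)
  then have G0: "0 \<le> G $ k $ l" for k l
    by (simp add: less_eq_vec_def column_def)
  define k where "k = rc i"
  \<comment> \<open>Adding \<open>i\<close> to \<open>S\<close> is a rank-one update of
    \<open>M\<close> at position \<open>(i, k)\<close>. As in the Sherman-Morrison formula,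
    \<open>G $ k $ i < 1\<close> would preserve inverse positivity, against the maximality of
    \<open>S\<close>.\<close>
  have G_ki: "1 \<le> G $ k $ i"
  proof (rule ccontr)
    assume less: "\<not> 1 \<le> G $ k $ i"
    have "inverse_positive (partial_matrix C (insert i S))"
      unfolding inverse_positive_def
    proof (intro allI impI)
      fix z assume z: "partial_matrix C (insert i S) *v z \<le> z"
      have split: "partial_matrix C (insert i S) *v z = M *v z + z $ k *s axis i 1"
        using i by (auto simp: vec_eq_iff partial_matrix_mult_nth M_def axis_def k_def)
      have "0 \<le> z - z $ k *s column i G"
      proof (rule inverse_positiveD[OF ip])
        have "M *v (z - z $ k *s column i G) = M *v z - z $ k *s (column i G - axis i 1)"
          by (simp add: matrix_vector_mult_diff_distrib vector_scalar_commute col)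
        also have "\<dots> \<le> z - z $ k *s column i G"
          using z by (simp add: split less_eq_vec_def algebra_simps)
        finally show "M *v (z - z $ k *s column i G) \<le> z - z $ k *s column i G" .
      qed
      then have z_ge: "z $ k * G $ j $ i \<le> z $ j" for j
        by (simp add: less_eq_vec_def column_def)
      from z_ge[of k] have "0 \<le> z $ k * (1 - G $ k $ i)" by (simp add: algebra_simps)
      then have "0 \<le> z $ k" using less by (simp add: zero_le_mult_iff)
      then have "0 \<le> z $ j" for j
        using z_ge[of j] G0[of j i] by (meson mult_nonneg_nonneg order_trans)
      then show "0 \<le> z" by (simp add: less_eq_vec_def)
    qed
    with not_ip show False ..
  qed
  define u where "u = (\<chi> i. if i \<in> C then v $ i else 0)"
  let ?CQ = "C \<inter> Q"
  let ?prod = "\<lambda>l. v $ lc l * v $ rc l"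
  \<comment> \<open>Only quadratic rows leave a residual: the omitted second child, if any, minus
    the product term of \<open>v_quad\<close>.\<close>
  have residual: "(u - M *v u) $ l =
      (if l \<in> ?CQ then (if l \<in> S then 0 else v $ rc l) - ?prod l else 0)" for l
  proof -
    consider "l \<notin> C" | "l \<in> C" "l \<in> Q" | "l \<in> C" "l \<notin> Q" by blast
    then show ?thesis
    proof cases
      case 1
      then show ?thesis by (simp add: M_def partial_matrix_mult_nth u_def)
    next
      case 2
      then have "lc l \<in> C" "rc l \<in> C" using closed edges_quad by blast+
      then show ?thesis using 2 v_quad[of l] by (simp add: M_def partial_matrix_mult_nth u_def)
    next
      case 3
      have "A l j * u $ j = A l j * v $ j" for j
        using closed[OF 3(1) edges_lin[OF 3(2)], of j] A_nonneg[of l j]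
        by (cases "A l j = 0") (auto simp: u_def)
      then have "(\<Sum>j\<in>UNIV. A l j * u $ j) = (\<Sum>j\<in>UNIV. A l j * v $ j)"
        by (intro sum.cong) simp_all
      moreover have "u $ l = v $ l" using 3 by (simp add: u_def)
      ultimately show ?thesis
        using 3 v_lin[of l] no_leak by (simp add: M_def partial_matrix_mult_nth)
    qed
  qed
  have kC: "k \<in> C" using closed[of i k] edges_quad[of i] i by (auto simp: k_def)
  have "u = G *v (u - M *v u)"
    using G(1) by (metis matrix_vector_mul_assoc matrix_vector_mul_lid matrix_vector_mult_diff_rdistrib)
  then have "v $ k = (G *v (u - M *v u)) $ k" using kC by (metis (mono_tags, lifting) u_def vec_lambda_beta)
  also have "\<dots> = (\<Sum>l\<in>UNIV. G $ k $ l * (u - M *v u) $ l)"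
    by (simp add: matrix_vector_mult_def)
  also have "\<dots> = (\<Sum>l\<in>?CQ. G $ k $ l * ((if l \<in> S then 0 else v $ rc l) - ?prod l))"
    unfolding residual by (rule sum.mono_neutral_cong_right) auto
  also have "\<dots> = (\<Sum>l\<in>?CQ. if l \<in> S then 0 else G $ k $ l * v $ rc l) - (\<Sum>l\<in>?CQ. G $ k $ l * ?prod l)"
    unfolding sum_subtractf[symmetric] by (intro sum.cong) (auto simp: algebra_simps)
  also have "(\<Sum>l\<in>?CQ. if l \<in> S then 0 else G $ k $ l * v $ rc l) = (\<Sum>l\<in>?CQ - S. G $ k $ l * v $ rc l)"
    by (rule sum.mono_neutral_cong_right) auto
  finally have "(\<Sum>l\<in>?CQ. G $ k $ l * ?prod l) = (\<Sum>l\<in>?CQ - S. G $ k $ l * v $ rc l) - v $ k"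
    by simp
  \<comment> \<open>Since \<open>k = rc i\<close>, the left side is absorbed into the summand
    \<open>l = i\<close>, whose coefficient stays nonnegative by \<open>G_ki\<close>.\<close>
  also have "v $ k = (\<Sum>l\<in>?CQ - S. of_bool (l = i) * v $ rc l)"
    using i by (subst sum.remove[of _ i]) (auto simp: k_def intro!: sum.neutral)
  finally have balance: "(\<Sum>l\<in>?CQ. G $ k $ l * ?prod l)
      = (\<Sum>l\<in>?CQ - S. (G $ k $ l - of_bool (l = i)) * v $ rc l)"
    by (simp add: left_diff_distrib sum_subtractf)
  have terms0: "0 \<le> (G $ k $ l - of_bool (l = i)) * v $ rc l" for l
    using G_ki G0[of k l] v_pos[of "rc l"] by (cases "l = i") auto
  have prod_pos: "0 < ?prod l" for l using v_pos by simp
  have "0 < G $ k $ i" using G_ki by simp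
  then have "0 < G $ k $ i * ?prod i" using prod_pos[of i] by (rule mult_pos_pos)
  also have "\<dots> \<le> (\<Sum>l\<in>?CQ. G $ k $ l * ?prod l)"
    using i G0 prod_pos by (intro member_le_sum) (auto simp: less_imp_le)
  finally obtain l where l: "l \<in> ?CQ - S" "(G $ k $ l - of_bool (l = i)) * v $ rc l \<noteq> 0"
    unfolding balance by (metis (no_types, lifting) less_irrefl sum.neutral)
  have excess: "(G $ k $ l - of_bool (l = i)) * v $ rc l \<le> (\<Sum>l\<in>?CQ. G $ k $ l * ?prod l)"
    unfolding balance using l terms0 by (intro member_le_sum) auto
  \<comment> \<open>Multiplying the nonzero coefficient by \<open>\<Delta>\<close> gives
    \<open>?X\<close>, and \<open>D * ?X\<close> is a nonzero integer. One factor \<open>D\<close>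
    is spent here, another on the path from \<open>rc l\<close> to \<open>a\<close>.\<close>
  let ?X = "N k l - of_bool (l = i) * \<Delta>" and ?e = "v $ a"
  have X: "?X = (G $ k $ l - of_bool (l = i)) * \<Delta>" by (simp add: GN left_diff_distrib)
  have "?X \<noteq> 0" using l(2) \<Delta> X by auto
  moreover have "D * ?X \<in> \<int>"
    using N_Ints[of k l] \<Delta>_Ints by (cases "l = i") (auto simp: right_diff_distrib)
  ultimately have "1 \<le> \<bar>D * ?X\<bar>"
    using D_ge_1 by (intro pos_Ints_ge_1) auto
  then have X_ge: "1 \<le> D * \<bar>?X\<bar>" using D_ge_1 by (simp add: abs_mult)
  have "l \<in> C" using l by simp
  moreover have "(l, rc l) \<in> edges" using l edges_quad by blast
  ultimately have rcC: "rc l \<in> C" using closed by blast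
  have e0: "0 < ?e" by (rule v_pos)
  have "?e / D \<le> v $ rc l"
  proof (rule path_lower_bound[OF connected[OF rcC a(1)] e0])
    show "?e / d a \<le> ?e" using e0 d_ge_1[of a] by (simp add: divide_le_eq)
  qed
  then have v_ge: "?e \<le> D * v $ rc l" using D_ge_1 by (simp add: divide_le_eq mult.commute)
  have "?e \<le> (D * \<bar>?X\<bar>) * (D * v $ rc l)"
    using mult_mono[OF X_ge v_ge] e0 D_ge_1 by simp
  also have "\<dots> = D\<^sup>2 * (\<bar>?X\<bar> * v $ rc l)" by (simp add: power2_eq_square mult_ac)
  also have "\<bar>?X\<bar> * v $ rc l = ((G $ k $ l - of_bool (l = i)) * v $ rc l) * \<bar>\<Delta>\<bar>"
    using terms0[of l] v_pos[of "rc l"] unfolding X abs_mult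
    by (simp add: zero_le_mult_iff)
  also have "\<dots> \<le> (\<Sum>l\<in>?CQ. G $ k $ l * ?prod l) * \<bar>\<Delta>\<bar>"
    by (intro mult_right_mono excess) simp
  also have "\<dots> = (\<Sum>l\<in>?CQ. \<bar>N k l\<bar> * ?prod l)"
    unfolding sum_distrib_right by (intro sum.cong) (simp_all add: GN[symmetric] abs_mult G0)
  also have "\<dots> \<le> (\<Sum>l\<in>?CQ. 4 ^ CARD('a) * ?e\<^sup>2)"
  proof (intro sum_mono)
    fix l assume "l \<in> ?CQ"
    then have "lc l \<in> C" "rc l \<in> C" using closed edges_quad by blast+
    then have "?prod l \<le> ?e\<^sup>2"
      unfolding power2_eq_square using a(2) v_pos by (intro mult_mono) (auto simp: less_imp_le)
    then show "\<bar>N k l\<bar> * ?prod l \<le> 4 ^ CARD('a) * ?e\<^sup>2"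
      using N_le prod_pos by (intro mult_mono) (auto simp: less_imp_le)
  qed
  \<comment> \<open>The 8 is 4 from the cofactor bound times 2 from the number of summands, at most
    \<open>2 ^ CARD('a)\<close>.\<close>
  also have "\<dots> \<le> 8 ^ CARD('a) * ?e\<^sup>2"
  proof -
    have "card ?CQ \<le> CARD('a)" by (intro card_mono) auto
    also have "\<dots> \<le> 2 ^ CARD('a)" by (rule less_imp_le[OF less_exp])
    finally have "real (card ?CQ) \<le> 2 ^ CARD('a)"
      using of_nat_le_iff[where 'a = real] by fastforce
    then have "real (card ?CQ) * (4 ^ CARD('a) * ?e\<^sup>2) \<le> 2 ^ CARD('a) * (4 ^ CARD('a) * ?e\<^sup>2)"
      by (intro mult_right_mono) auto
    also have "\<dots> = (2 * 4) ^ CARD('a) * ?e\<^sup>2" by (simp only: power_mult_distrib mult.assoc)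
    finally show ?thesis by simp
  qed
  finally have "?e \<le> D\<^sup>2 * (8 ^ CARD('a) * ?e\<^sup>2)" using D_ge_1 by (simp add: mult_left_mono)
  then have "1 * ?e \<le> (8 ^ CARD('a) * D\<^sup>2 * ?e) * ?e" by (simp add: power2_eq_square mult_ac)
  then show ?thesis using e0 by (simp only: mult_le_cancel_right_pos)
qed

text \<open>A bottom component reachable from \<open>i\<close> either leaks, at cost
  \<open>D\<close>, or has a large maximum, at cost \<open>8 ^ CARD('a) * D\<^sup>2\<close> and a
  further \<open>D\<close> for the path from \<open>i\<close>.\<close>

theorem v_lower_bound: "1 \<le> 8 ^ CARD('a) * D ^ 3 * v $ i"
proof -
  let ?reach = "\<lambda>i. edges\<^sup>* `` {i}"
  \<comment> \<open>Minimal cardinality forces every vertex reachable from \<open>m\<close> to reach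
    the same set, so this set is a bottom strongly connected component.\<close>
  obtain m where m: "(i, m) \<in> edges\<^sup>*"
    and min: "\<And>j. (i, j) \<in> edges\<^sup>* \<Longrightarrow> card (?reach m) \<le> card (?reach j)"
    using ex_has_least_nat[of "\<lambda>j. (i, j) \<in> edges\<^sup>*" i "\<lambda>j. card (?reach j)"] by blast
  define C where "C = ?reach m"
  have reach_eq: "?reach j = C" if "j \<in> C" for j
  proof (rule card_subset_eq)
    have mj: "(m, j) \<in> edges\<^sup>*" using that by (simp add: C_def)
    show sub: "?reach j \<subseteq> C" using mj by (auto simp: C_def)
    have "card C \<le> card (?reach j)"
      unfolding C_def using min m mj by (meson rtrancl_trans)
    moreover have "card (?reach j) \<le> card C" by (rule card_mono[OF _ sub]) simp
    ultimately show "card (?reach j) = card C" by simp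
  qed simp
  have iC: "(i, j) \<in> edges\<^sup>*" if "j \<in> C" for j
    using that m by (auto simp: C_def)
  have DD: "1 \<le> 8 ^ CARD('a) * D\<^sup>2"
    using D_ge_1 by (simp add: mult_ge1_I)
  show ?thesis
  proof (cases "\<exists>j\<in>C. j \<notin> Q \<and> leak j \<noteq> 0")
    case True
    then have "1 / D \<le> v $ i" using leak_lower_bound iC by blast
    then have "1 \<le> D * v $ i" using D_ge_1 by (simp add: divide_le_eq mult.commute)
    then have "1 \<le> (8 ^ CARD('a) * D\<^sup>2) * (D * v $ i)"
      using DD by (rule mult_ge1_I[rotated])
    then show ?thesis by (simp add: power2_eq_square power3_eq_cube mult_ac)
  next
    case False
    have "m \<in> C" by (simp add: C_def)
    then have "Max ((\<lambda>j. v $ j) ` C) \<in> (\<lambda>j. v $ j) ` C" by (intro Max_in) auto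
    then obtain a where a: "a \<in> C" "Max ((\<lambda>j. v $ j) ` C) = v $ a" by auto
    have a_max: "v $ j \<le> v $ a" if "j \<in> C" for j
      unfolding a(2)[symmetric] using that by (intro Max_ge) auto
    have "1 \<le> 8 ^ CARD('a) * D\<^sup>2 * v $ a"
    proof (rule scc_max_lower_bound[OF _ _ _ a(1) a_max])
      show "edges `` C \<subseteq> C" by (auto simp: C_def)
      show "(j, k) \<in> edges\<^sup>*" if "j \<in> C" "k \<in> C" for j k
        using reach_eq[OF that(1)] that(2) by blast
      show "\<forall>j\<in>C - Q. leak j = 0" using False by blast
    qed
    also have "v $ a \<le> D * v $ i"
    proof -
      have "v $ a / D \<le> v $ i"
      proof (rule path_lower_bound[OF iC[OF a(1)] v_pos])
        show "v $ a / d a \<le> v $ a" using v_pos[of a] d_ge_1[of a] by (simp add: divide_le_eq)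
      qed
      then show ?thesis using D_ge_1 by (simp add: divide_le_eq mult.commute)
    qed
    finally show ?thesis
      using D_ge_1 by (simp add: power2_eq_square power3_eq_cube mult_ac mult_left_mono)
  qed
qed

end

section \<open>Evaluation and bit size of the polynomials\<close>

lemma eval_quadratic_monomial:
  fixes x :: "real ^ 'n::finite"
  shows "eval_polynomial (Poly_Mapping.single (Poly_Mapping.single j 1 + Poly_Mapping.single k 1) 1) x
    = x $ j * x $ k"
proof -
  have *: "(\<Prod>i\<in>UNIV. x $ i ^ (Suc 0 when j = i)) = x $ j" for j
    by (subst prod.remove[of _ j]) (auto simp: when_def intro!: prod.neutral)
  show ?thesis
    by (simp add: eval_polynomial_def lookup_add lookup_single power_add prod.distrib *)
qed

lemma eval_linear_expression:
  fixes x :: "real ^ 'n::finite"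
  assumes "linear_expression p"
  shows "eval_polynomial p x = of_rat (Poly_Mapping.lookup p 0) +
    (\<Sum>j\<in>UNIV. of_rat (Poly_Mapping.lookup p (Poly_Mapping.single j 1)) * x $ j)"
proof -
  let ?s = "\<lambda>j :: 'n. Poly_Mapping.single j (1 :: nat)"
  let ?t = "\<lambda>m. of_rat (Poly_Mapping.lookup p m) * (\<Prod>j\<in>UNIV. x $ j ^ Poly_Mapping.lookup m j)"
  have single: "(\<Prod>i\<in>UNIV. x $ i ^ Poly_Mapping.lookup (?s j) i) = x $ j" for j
    by (subst prod.remove[of _ j]) (auto simp: lookup_single when_def intro!: prod.neutral)
  have s_inj: "inj ?s"
    by (rule injI) (metis lookup_single_eq lookup_single_not_eq zero_neq_one)
  have s_nz: "0 \<notin> range ?s"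
  proof
    assume "0 \<in> range ?s"
    then obtain j where "?s j = 0" by auto
    then have "Poly_Mapping.lookup (?s j) j = Poly_Mapping.lookup 0 j" by (rule arg_cong)
    then show False by simp
  qed
  have "eval_polynomial p x = (\<Sum>m\<in>insert 0 (range ?s). ?t m)"
    unfolding eval_polynomial_def
    using assms by (intro sum.mono_neutral_left) (auto simp: linear_expression_def in_keys_iff)
  also have "\<dots> = ?t 0 + (\<Sum>m\<in>range ?s. ?t m)"
    using s_nz by simp
  also have "(\<Sum>m\<in>range ?s. ?t m) = (\<Sum>j\<in>UNIV. ?t (?s j))"
    by (simp only: sum.reindex[OF s_inj] comp_def)
  finally show ?thesis unfolding single by simp
qed

lemma eval_substochastic_one_le:
  assumes "substochastic p"
  shows "eval_polynomial p 1 \<le> 1"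
proof -
  have "eval_polynomial p 1 = of_rat (\<Sum>m\<in>Poly_Mapping.keys p. Poly_Mapping.lookup p m)"
    by (simp add: eval_polynomial_def of_rat_sum)
  also have "\<dots> \<le> 1" using assms by (simp add: substochastic_def)
  finally show ?thesis .
qed

text \<open>Serves as the common denominator of a row. A product is convenient because bit lengths
  add up under multiplication.\<close>

definition denominator_product :: "'n polynomial \<Rightarrow> nat" where
  "denominator_product p = (\<Prod>m\<in>Poly_Mapping.keys p. nat (snd (quotient_of (Poly_Mapping.lookup p m))))"

lemma denominator_product_pos: "1 \<le> denominator_product p"
  unfolding denominator_product_def using quotient_of_denom_pos' by (intro prod_ge_1) (simp add: Suc_le_eq)

lemma denominator_product_Ints:
  "real (denominator_product p) * of_rat (Poly_Mapping.lookup p m) \<in> \<int>"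
proof (cases "m \<in> Poly_Mapping.keys p")
  case True
  obtain a b where ab: "quotient_of (Poly_Mapping.lookup p m) = (a, b)" by force
  have b: "0 < b" by (rule quotient_of_denom_pos[OF ab])
  have r: "(of_rat (Poly_Mapping.lookup p m) :: real) = of_int a / of_int b"
    using quotient_of_div[OF ab] by (simp add: of_rat_divide)
  have "real (denominator_product p) = of_int b *
      real (\<Prod>m\<in>Poly_Mapping.keys p - {m}. nat (snd (quotient_of (Poly_Mapping.lookup p m))))"
    unfolding denominator_product_def using True b by (subst prod.remove[of _ m]) (auto simp: ab)
  then have "real (denominator_product p) * of_rat (Poly_Mapping.lookup p m) = of_int a *
      real (\<Prod>m\<in>Poly_Mapping.keys p - {m}. nat (snd (quotient_of (Poly_Mapping.lookup p m))))"
    using b by (simp add: r)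
  also have "\<dots> \<in> \<int>" by (intro Ints_mult Ints_of_int Ints_of_nat)
  finally show ?thesis .
qed (simp add: in_keys_iff)

lemma le_two_power_bitlen:
  assumes "0 < b"
  shows "nat b \<le> 2 ^ nat (bitlen b)"
proof -
  have "b < 2 ^ nat (bitlen b)" using bitlen_bounds[OF assms] by simp
  then have "nat b < nat (2 ^ nat (bitlen b))" using assms by (simp add: nat_less_iff)
  then show ?thesis by (simp add: nat_power_eq)
qed

lemma denominator_product_le: "denominator_product p \<le> 2 ^ polynomial_bits p"
proof -
  have "nat (snd (quotient_of r)) \<le> 2 ^ rat_bits r" for r
  proof -
    obtain a b where ab: "quotient_of r = (a, b)" by force
    have "nat b \<le> 2 ^ nat (bitlen b)"
      by (rule le_two_power_bitlen[OF quotient_of_denom_pos[OF ab]])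
    also have "\<dots> \<le> 2 ^ rat_bits r" by (intro power_increasing) (simp_all add: rat_bits_def ab)
    finally show ?thesis by (simp add: ab)
  qed
  then have "denominator_product p \<le> (\<Prod>m\<in>Poly_Mapping.keys p. 2 ^ rat_bits (Poly_Mapping.lookup p m))"
    unfolding denominator_product_def by (intro prod_mono) auto
  also have "\<dots> = 2 ^ (\<Sum>m\<in>Poly_Mapping.keys p. rat_bits (Poly_Mapping.lookup p m))"
    by (simp add: power_sum)
  also have "\<dots> \<le> 2 ^ polynomial_bits p"
    unfolding polynomial_bits_def by (intro power_increasing sum_mono) auto
  finally show ?thesis .
qed

text \<open>As \<open>matrix_inv\<close> is total, the first conjunct certifies that every iterate
  is a genuine Newton step.\<close>

theorem theorem3p2:
  fixes P :: "'n::finite poly_system"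
    and q :: "real ^ 'n"
    and x :: "nat \<Rightarrow> real ^ 'n"
  assumes "is_PPS P"
    and "in_SNF P"
    and "is_LFP P q"
    and "\<forall>i. 0 < q $ i \<and> q $ i < 1"
    and "x 0 = 0"
    and "\<forall>k. x (Suc k) = newton P (x k)"
  shows "(\<forall>k. invertible (mat 1 - Jacobian_matrix P (x k))) \<and>
         (\<forall>j. infnorm (q - x (j + 4 * system_size P)) \<le> 1 / 2 ^ j)"
proof -
  define Q where "Q = {i. quadratic_monomial (P i)}"
  have "\<forall>i. \<exists>j k. i \<in> Q \<longrightarrow>
      P i = Poly_Mapping.single (Poly_Mapping.single j 1 + Poly_Mapping.single k 1) 1"
    by (auto simp: Q_def quadratic_monomial_def)
  then obtain lc rc where quad: "\<And>i. i \<in> Q \<Longrightarrow>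
      P i = Poly_Mapping.single (Poly_Mapping.single (lc i) 1 + Poly_Mapping.single (rc i) 1) 1"
    by metis
  have lin: "linear_expression (P i)" if "i \<notin> Q" for i
    using that \<open>in_SNF P\<close> by (auto simp: Q_def in_SNF_def)
  have sub: "substochastic (P i)" for i using \<open>is_PPS P\<close> by (simp add: is_PPS_def)
  define A :: "'n \<Rightarrow> 'n \<Rightarrow> real" where
    "A i j = (if i \<in> Q then 0 else of_rat (Poly_Mapping.lookup (P i) (Poly_Mapping.single j 1)))" for i j
  define b :: "'n \<Rightarrow> real" where
    "b i = (if i \<in> Q then 0 else of_rat (Poly_Mapping.lookup (P i) 0))" for i
  let ?F = "eval_system P" and ?d = "\<lambda>i. denominator_product (P i)"
  have F_nth: "?F x $ i = (if i \<in> Q then x $ lc i * x $ rc i else b i + (\<Sum>j\<in>UNIV. A i j * x $ j))" for x i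
    using eval_quadratic_monomial[of "lc i" "rc i" x] eval_linear_expression[OF lin, of i x]
    by (simp add: eval_system_def quad A_def b_def)
  interpret snf_denominators Q lc rc A b q ?F ?d
  proof unfold_locales
    show "0 \<le> A i j" "0 \<le> b i" for i j
      using sub[of i] by (simp_all add: A_def b_def substochastic_def)
    show "b i + (\<Sum>j\<in>UNIV. A i j) \<le> 1" for i
      using eval_substochastic_one_le[OF sub, of i] F_nth[of 1 i]
      by (cases "i \<in> Q") (simp_all add: eval_system_def, simp add: A_def b_def)
    show "real (?d i) * A i j \<in> \<int>" "real (?d i) * b i \<in> \<int>" if "i \<notin> Q" for i j
      using denominator_product_Ints that by (simp_all add: A_def b_def)
    show "1 \<le> ?d i" for i by (rule denominator_product_pos)
    show "?F x $ i = (if i \<in> Q then x $ lc i * x $ rc i else b i + (\<Sum>j\<in>UNIV. A i j * x $ j))" for x i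
      by (rule F_nth)
    show "?F q = q" "0 \<le> y \<Longrightarrow> ?F y = y \<Longrightarrow> q \<le> y" for y
      using \<open>is_LFP P q\<close> unfolding is_LFP_def by blast+
    show "0 < q $ i" "q $ i < 1" for i
      using assms(4) by blast+
  qed
  let ?s = "4 * system_size P"
  have "D \<le> (\<Prod>i\<in>(UNIV :: 'n set). 2 ^ polynomial_bits (P i))"
    unfolding D_def
  proof (rule prod_mono, rule conjI)
    fix i
    show "real (?d i) \<le> 2 ^ polynomial_bits (P i)"
      using denominator_product_le[of "P i"] of_nat_le_iff[where 'a = real] by fastforce
  qed simp
  then have D_le: "D \<le> 2 ^ (\<Sum>i\<in>UNIV. polynomial_bits (P i))"
    by (simp add: power_sum)
  \<comment> \<open>With \<open>8 = 2 ^ 3\<close> the product is at most 2 to the power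
    \<open>3 * system_size P\<close>.\<close>
  have "8 ^ CARD('n) * D ^ 3 \<le> 8 ^ CARD('n) * (2 ^ (\<Sum>i\<in>UNIV. polynomial_bits (P i))) ^ 3"
    using D_le D_ge_1 by (intro mult_left_mono power_mono) auto
  also have "\<dots> = 2 ^ (3 * CARD('n) + 3 * (\<Sum>i\<in>UNIV. polynomial_bits (P i)))"
    by (simp only: power_add power_mult power_mult[symmetric, of 2 _ 3] mult.commute[of _ 3]) simp
  also have "\<dots> \<le> 2 ^ ?s"
    by (intro power_increasing) (simp_all add: system_size_def)
  finally have size: "8 ^ CARD('n) * D ^ 3 \<le> (2 :: real) ^ ?s" .
  have v_ge: "1 \<le> 2 ^ ?s * v $ i" for i
    using v_lower_bound[of i] mult_right_mono[OF size less_imp_le[OF v_pos[of i]]] by (rule order_trans)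
  have J: "Jacobian_matrix P z = B z" for z
    by (simp add: Jacobian_matrix_def jacobian_F)
  \<comment> \<open>The initial error is \<open>q\<close>, whose entries are below 1, and the
    entries of \<open>2 ^ ?s *s v\<close> are at least 1. The first \<open>?s\<close> halvings use
    up this factor, the remaining \<open>j\<close> give the claimed rate.\<close>
  have start: "q \<le> (2 ^ ?s) *s v"
    unfolding less_eq_vec_def using order_trans[OF less_imp_le[OF q_less_1] v_ge] by simp
  have seq: "0 \<le> x k \<and> x k \<le> q \<and> x k \<le> ?F (x k) \<and> q - x k \<le> (2 ^ ?s / 2 ^ k) *s v" for k
    using assms(5,6) by (intro newton_sequence start) (simp_all add: newton_def J)
  have "infnorm (q - x (j + ?s)) \<le> 1 / 2 ^ j" for j
  proof -
    have "\<bar>(q - x (j + ?s)) $ i\<bar> \<le> 1 / 2 ^ j" for i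
    proof -
      have "0 \<le> (q - x (j + ?s)) $ i"
        using seq[of "j + ?s"] by (simp add: less_eq_vec_def)
      moreover have "(q - x (j + ?s)) $ i \<le> (2 ^ ?s / 2 ^ (j + ?s)) * v $ i"
        using seq[of "j + ?s"] by (simp add: less_eq_vec_def)
      moreover have "(2 ^ ?s / 2 ^ (j + ?s)) * v $ i \<le> 1 / 2 ^ j * 1"
        using v_less_1[of i] by (intro mult_mono) (auto simp: power_add v_pos less_imp_le)
      ultimately show ?thesis by linarith
    qed
    then show ?thesis
      unfolding infnorm_cart by (intro cSup_least) auto
  qed
  moreover have "invertible (mat 1 - Jacobian_matrix P (x k))" for k
    unfolding J using seq[of k] by (intro inverse_positive_invertible B_inverse_positive) auto
  ultimately show ?thesis by blast
qed

end
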